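(* Let $p$ be an odd prime and $k$ a field of characteristic $p$. Let $f \in k[[\zeta]]$ be of the form $$f(\zeta) = \zeta\left(-1 + \sum_{j=1}^{+\infty} a_j\zeta^j\right).$$ Then $f^2$ is $2$-ramified if and only if $$(a_1^2 + a_2)\left(11a_1^4 + 25a_1^2a_2 + 12a_1a_3 + 6a_2^2 + 4a_4\right) \neq 0.$$
   Context: For a power series $h$ with $h(0)=0$, $h^n$ denotes the $n$-fold composition of $h$ with itself; in particular $f^2 = f\circ f$. The order $\mathrm{ord}(h)$ of a nonzero power series $h \in k[[\zeta]]$ is the lowest degree of its nonzero terms, and $\mathrm{ord}(0) := +\infty$. For a power series $g(\zeta) = \zeta + \cdots \in k[[\zeta]]$ (i.e. $g(0)=0$ and linear coefficient $1$) and integers $n \geq 0$, the lower ramification number of $g$ is $$i_n(g) := \mathrm{ord}\left(\frac{g^{p^n}(\zeta)-\zeta}{\zeta}\right).$$ The series $g$ is called $2$-ramified if $i_n(g) = 2(1+p+\cdots+p^n)$ for all integers $n \geq 0$. *)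

theory Defs
  imports
    "HOL-Computational_Algebra.Formal_Power_Series"
    "HOL-Library.Extended_Nat"
begin

unbundle fps_syntax

text \<open>
  Iterated composition. Composition \<^term>\<open>g oo h\<close> of formal power series is meaningful
  only when \<^term>\<open>h $ 0 = 0\<close>, so this is used only for series without constant term.
\<close>
definition fps_iterate :: "nat \<Rightarrow> 'a :: comm_ring_1 fps \<Rightarrow> 'a fps" where
  "fps_iterate n g = ((\<lambda>h. g oo h) ^^ n) fps_X"

text \<open>Unlike \<^const>\<open>subdegree\<close>, this is infinite at 0.\<close>
definition fps_ord :: "'a :: zero fps \<Rightarrow> enat" where
  "fps_ord h = (if h = 0 then \<infinity> else enat (subdegree h))"

text \<open>
  The quotient is exact whenever \<^term>\<open>g $ 0 = 0\<close>. The parameter \<open>p\<close> is meant to be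
  the characteristic of the coefficient field.
\<close>
definition lower_ramification :: "nat \<Rightarrow> nat \<Rightarrow> 'a :: field fps \<Rightarrow> enat" where
  "lower_ramification p n g = fps_ord ((fps_iterate (p ^ n) g - fps_X) / fps_X)"

definition two_ramified :: "nat \<Rightarrow> 'a :: field fps \<Rightarrow> bool" where
  "two_ramified p g \<longleftrightarrow> g $ 0 = 0 \<and> g $ 1 = 1 \<and>
     (\<forall>n. lower_ramification p n g = enat (2 * (\<Sum>i\<le>n. p ^ i)))"

end

theory Submission
  imports Defs
begin

text \<open>
  In characteristic \<open>p\<close> the iterate \<open>h\<^sup>p\<close> equals \<open>\<zeta> + T\<^sup>p \<zeta>\<close> for the difference operator
  \<open>T \<phi> = \<phi> \<circ> h - \<phi>\<close>. If \<open>h = \<zeta> + b\<^sub>0 \<zeta>\<^bsup>m+1\<^esup> + b\<^sub>1 \<zeta>\<^bsup>m+2\<^esup> + b\<^sub>2 \<zeta>\<^bsup>m+3\<^esup> + \<dots>\<close> with \<open>b\<^sub>0 \<noteq> 0\<close> and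
  \<open>m \<equiv> 2\<close> modulo \<open>p\<close>, the three lowest coefficients of \<open>T\<^sup>j \<zeta>\<close> obey a linear recursion, and for
  \<open>j = p\<close> the first two vanish while the third, at degree \<open>pm + 3\<close>, is a unit times
  \<open>2b\<^sub>1\<^sup>2 - 2b\<^sub>0b\<^sub>2\<close>, plus \<open>3b\<^sub>0\<^sup>3\<close> when \<open>m = 2\<close>. So the ramification number rises from \<open>m\<close> to the
  required \<open>pm + 2\<close> iff that expression is nonzero. For the later iterates \<open>h\<close> of \<open>g = f\<^sup>2\<close>, comparing
  coefficients in \<open>h \<circ> g = g \<circ> h\<close> expresses \<open>b\<^sub>1/b\<^sub>0\<close> and \<open>b\<^sub>2/b\<^sub>0\<close> through the coefficients of \<open>g\<close>,
  which turns the condition for \<open>h\<close> into the one for \<open>g\<close>; hence the first step decides them all.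
\<close>

section \<open>Iterates as powers of right composition\<close>

text \<open>Right composition is preferred because \<open>\<phi> oo g\<close> is additive in
  \<open>\<phi>\<close>, while \<open>g oo \<phi>\<close> is not. The two iterations agree since
  \<open>g\<close> commutes with its own iterates.\<close>

lemma fps_iterate_conv_compose_right:
  fixes g :: "'a::idom fps"
  assumes "g $ 0 = 0"
  shows "fps_iterate n g = ((\<lambda>\<phi>. \<phi> oo g) ^^ n) fps_X"
proof -
  have comm: "g oo ((\<lambda>\<phi>. \<phi> oo g) ^^ n) \<phi> = ((\<lambda>\<phi>. \<phi> oo g) ^^ n) (g oo \<phi>)" if "\<phi> $ 0 = 0" for n \<phi>
    using that
  proof (induction n arbitrary: \<phi>)
    case (Suc n)
    have "g oo ((\<lambda>\<phi>. \<phi> oo g) ^^ n) (\<phi> oo g) = ((\<lambda>\<phi>. \<phi> oo g) ^^ n) (g oo (\<phi> oo g))"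
      by (rule Suc.IH) (simp add: Suc.prems)
    then show ?case
      using Suc.prems assms by (simp add: funpow_Suc_right fps_compose_assoc del: funpow.simps)
  qed simp
  show ?thesis
    unfolding fps_iterate_def
  proof (induction n)
    case (Suc n)
    have "((oo) g ^^ Suc n) fps_X = g oo ((\<lambda>\<phi>. \<phi> oo g) ^^ n) fps_X"
      by (simp add: Suc.IH)
    also have "\<dots> = ((\<lambda>\<phi>. \<phi> oo g) ^^ Suc n) fps_X"
      using assms by (simp add: comm funpow_Suc_right del: funpow.simps)
    finally show ?case .
  qed simp
qed

lemma fps_compose_funpow:
  fixes g :: "'a::idom fps"
  assumes "g $ 0 = 0"
  shows "((\<lambda>\<phi>. \<phi> oo g) ^^ n) \<phi> = \<phi> oo fps_iterate n g \<and> fps_iterate n g $ 0 = 0"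
proof (induction n)
  case 0
  then show ?case by (simp add: fps_iterate_def)
next
  case (Suc n)
  have "fps_iterate (Suc n) g = fps_iterate n g oo g"
    using assms by (simp add: fps_iterate_conv_compose_right)
  then show ?case
    using Suc assms by (simp add: fps_compose_assoc)
qed

lemma fps_iterate_nth_0: "g $ 0 = 0 \<Longrightarrow> fps_iterate n g $ 0 = (0::'a::idom)"
  using fps_compose_funpow by blast

lemma fps_iterate_mult:
  fixes g :: "'a::idom fps"
  assumes "g $ 0 = 0"
  shows "fps_iterate (m * n) g = fps_iterate n (fps_iterate m g)"
proof -
  have "fps_iterate (m * n) g = (((\<lambda>\<phi>. \<phi> oo g) ^^ m) ^^ n) fps_X"
    using assms by (simp add: fps_iterate_conv_compose_right funpow_mult mult.commute)
  also have "((\<lambda>\<phi>. \<phi> oo g) ^^ m) = (\<lambda>\<phi>. \<phi> oo fps_iterate m g)"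
    using fps_compose_funpow[OF assms] by auto
  finally show ?thesis
    using assms by (simp only: fps_iterate_conv_compose_right[of "fps_iterate m g"] fps_iterate_nth_0)
qed

lemma fps_iterate_commute:
  fixes g :: "'a::idom fps"
  assumes "g $ 0 = 0"
  shows "fps_iterate n g oo g = g oo fps_iterate n g"
proof -
  have "fps_iterate n g oo g = fps_iterate (Suc n) g"
    using assms by (simp add: fps_iterate_conv_compose_right)
  then show ?thesis
    by (simp add: fps_iterate_def)
qed

section \<open>The difference operator in characteristic \<open>p\<close>\<close>

definition compose_diff :: "'a::comm_ring_1 fps \<Rightarrow> 'a fps \<Rightarrow> 'a fps" where
  "compose_diff h \<phi> = (\<phi> oo h) - \<phi>"

text \<open>The binomial theorem for \<open>S = 1 + T\<close>: additivity passes from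
  \<open>S\<close> to \<open>T\<close>, so \<open>T\<close> commutes with natural multiples and
  Pascal's rule gives the induction step.\<close>

lemma funpow_binomial:
  fixes S T :: "'a::comm_ring_1 \<Rightarrow> 'a"
  assumes S: "\<And>x. S x = x + T x"
    and add: "\<And>x y. S (x + y) = S x + S y"
  shows "(S ^^ n) x = (\<Sum>i\<le>n. of_nat (n choose i) * (T ^^ i) x)"
proof -
  have T_add: "T (x + y) = T x + T y" for x y
    using add[of x y] S[of x] S[of y] S[of "x+y"] by (simp add: algebra_simps)
  have T_0: "T 0 = 0"
    using T_add[of 0 0] by simp
  have T_nat: "T (of_nat c * y) = of_nat c * T y" for c y
    by (induction c) (simp_all add: T_0 T_add algebra_simps)
  have T_sum: "T (\<Sum>i\<in>A. F i) = (\<Sum>i\<in>A. T (F i))" if "finite A" for A :: "nat set" and F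
    using that by (induction A) (simp_all add: T_0 T_add)
  show ?thesis
  proof (induction n)
    case (Suc n)
    have "(S ^^ Suc n) x = (\<Sum>i\<le>n. of_nat (n choose i) * (T ^^ i) x)
        + (\<Sum>i\<le>n. of_nat (n choose i) * (T ^^ Suc i) x)"
      by (simp add: Suc.IH S T_sum T_nat)
    also have "(\<Sum>i\<le>n. of_nat (n choose i) * (T ^^ i) x)
        = x + (\<Sum>i\<le>n. of_nat (n choose Suc i) * (T ^^ Suc i) x)"
      using sum.atMost_Suc_shift[of "\<lambda>i. of_nat (n choose i) * (T ^^ i) x" n]
      by (simp add: binomial_eq_0 del: funpow.simps(2))
    finally show ?case
      by (subst sum.atMost_Suc_shift) (simp add: sum.distrib algebra_simps)
  qed simp
qed

lemma fps_iterate_prime_char: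
  fixes h :: "'a::field fps"
  assumes p: "prime p" "CHAR('a) = p" and h: "h $ 0 = 0"
  shows "fps_iterate p h = fps_X + (compose_diff h ^^ p) fps_X"
proof -
  have zero: "(of_nat (p choose i) :: 'a fps) = 0" if "0 < i" "i < p" for i
  proof -
    have "p dvd (p choose i)"
      using that p by (intro dvd_choose_prime) auto
    then have "(of_nat (p choose i) :: 'a) = 0"
      using p by (simp add: of_nat_eq_0_iff_char_dvd)
    then show ?thesis
      by (simp add: fps_of_nat[symmetric])
  qed
  have "fps_iterate p h = (\<Sum>i\<le>p. of_nat (p choose i) * (compose_diff h ^^ i) fps_X)"
    unfolding fps_iterate_conv_compose_right[OF h]
    by (rule funpow_binomial) (simp_all add: compose_diff_def fps_compose_add_distrib)
  also have "\<dots> = (\<Sum>i\<in>{0,p}. of_nat (p choose i) * (compose_diff h ^^ i) fps_X)"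
    using zero by (intro sum.mono_neutral_right) auto
  also have "\<dots> = fps_X + (compose_diff h ^^ p) fps_X"
    using prime_gt_0_nat[OF p(1)] by simp
  finally show ?thesis .
qed

section \<open>Lowest coefficients of the difference operator\<close>

definition tangent_to_id :: "nat \<Rightarrow> 'a::comm_ring_1 fps \<Rightarrow> bool" where
  "tangent_to_id m h \<longleftrightarrow> (\<forall>i\<le>m. h $ i = fps_X $ i)"

text \<open>With \<open>W = 1 + fps_X ^ m * V\<close>, the power is
  \<open>1 + i * fps_X ^ m * V\<close> plus terms of degree at least \<open>2 * m\<close>. These
  reach degree \<open>m + 2\<close> only for \<open>m = 2\<close>, through the square of the
  constant term of \<open>V\<close>.\<close>

lemma one_plus_power_nth:
  fixes W :: "'a::comm_ring_1 fps"
  assumes W0: "W $ 0 = 1" and W: "\<And>l. 0 < l \<Longrightarrow> l < m \<Longrightarrow> W $ l = 0" and m: "m \<ge> 2"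
  shows "(W ^ i) $ 0 = 1"
    and "\<And>l. 0 < l \<Longrightarrow> l < m \<Longrightarrow> (W ^ i) $ l = 0"
    and "(W ^ i) $ m = of_nat i * W $ m"
    and "(W ^ i) $ (m + 1) = of_nat i * W $ (m + 1)"
    and "(W ^ i) $ (m + 2) = of_nat i * W $ (m + 2)
           + of_bool (m = 2) * of_nat (i choose 2) * (W $ m)\<^sup>2"
proof -
  define V where "V = fps_shift m W"
  have W_eq: "W = 1 + fps_X ^ m * V"
    using W W0 m by (auto simp: fps_eq_iff V_def fps_X_power_mult_nth)
  have step: "(W ^ Suc i) $ l = (W ^ i) $ l + (if l < m then 0 else (V * W ^ i) $ (l - m))" for i l
  proof -
    have "W ^ Suc i = W ^ i + fps_X ^ m * (V * W ^ i)"
      by (simp add: W_eq algebra_simps)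
    then show ?thesis
      by (simp only: fps_add_nth fps_X_power_mult_nth)
  qed
  have 0: "(W ^ i) $ 0 = 1" for i
    by (induction i) (simp_all add: W0)
  have low: "(W ^ i) $ l = 0" if "0 < l" "l < m" for i l
    using that by (induction i) (simp_all add: step del: power_Suc)
  have 1: "(W ^ i) $ m = of_nat i * W $ m" for i
    using m 0 by (induction i) (simp_all add: step V_def algebra_simps del: power_Suc)
  have 2: "(W ^ i) $ (m + 1) = of_nat i * W $ (m + 1)" for i
    using m 0 low
    by (induction i) (simp_all add: step V_def fps_mult_nth algebra_simps del: power_Suc)
  have W2: "(W ^ i) $ 2 = of_bool (m = 2) * of_nat i * W $ m" for i
    using low[of 2 i] 1[of i] m by (cases "m = 2") auto
  have 3: "(W ^ i) $ (m + 2) = of_nat i * W $ (m + 2)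
           + of_bool (m = 2) * of_nat (i choose 2) * (W $ m)\<^sup>2" for i
  proof (induction i)
    case 0
    then show ?case by (simp add: numeral_2_eq_2)
  next
    case (Suc i)
    have "(V * W ^ i) $ 2 = W $ m * (W ^ i) $ 2 + W $ (m + 1) * (W ^ i) $ 1 + W $ (m + 2)"
      using 0[of i] by (simp add: fps_mult_nth V_def numeral_2_eq_2 add.commute)
    also have "(W ^ i) $ 1 = 0"
      using low m by simp
    finally have "(V * W ^ i) $ 2 = of_bool (m = 2) * of_nat i * (W $ m)\<^sup>2 + W $ (m + 2)"
      by (simp add: W2 power2_eq_square)
    moreover have "Suc i choose 2 = i + (i choose 2)"
      by (simp add: numeral_2_eq_2)
    ultimately show ?case
      using Suc.IH by (simp add: step algebra_simps del: power_Suc)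
  qed
  show "(W ^ i) $ 0 = 1"
    and "\<And>l. 0 < l \<Longrightarrow> l < m \<Longrightarrow> (W ^ i) $ l = 0"
    and "(W ^ i) $ m = of_nat i * W $ m"
    and "(W ^ i) $ (m + 1) = of_nat i * W $ (m + 1)"
    and "(W ^ i) $ (m + 2) = of_nat i * W $ (m + 2)
           + of_bool (m = 2) * of_nat (i choose 2) * (W $ m)\<^sup>2"
    using 0 low 1 2 3 by blast+
qed

lemma compose_diff_nth:
  fixes h \<phi> :: "'a::comm_ring_1 fps"
  assumes h: "tangent_to_id m h" and m: "m \<ge> 2"
    and \<phi>: "\<And>i. i < k \<Longrightarrow> \<phi> $ i = 0"
  shows "\<And>n. n < k + m \<Longrightarrow> compose_diff h \<phi> $ n = 0"
    and "compose_diff h \<phi> $ (k + m) = of_nat k * \<phi> $ k * h $ (m + 1)"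
    and "compose_diff h \<phi> $ (k + m + 1) =
           of_nat k * \<phi> $ k * h $ (m + 2) + of_nat (k + 1) * \<phi> $ (k + 1) * h $ (m + 1)"
    and "compose_diff h \<phi> $ (k + m + 2) =
           \<phi> $ k * (of_nat k * h $ (m + 3) + of_bool (m = 2) * of_nat (k choose 2) * (h $ (m + 1))\<^sup>2)
           + of_nat (k + 1) * \<phi> $ (k + 1) * h $ (m + 2)
           + of_nat (k + 2) * \<phi> $ (k + 2) * h $ (m + 1)"
proof -
  define W where "W = fps_shift 1 h"
  have W0: "W $ 0 = 1" and Wlow: "\<And>l. 0 < l \<Longrightarrow> l < m \<Longrightarrow> W $ l = 0"
    using h m by (auto simp: W_def tangent_to_id_def)
  note Wpow = one_plus_power_nth[OF W0 Wlow m]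
  have h_eq: "h = fps_X * W"
    using h m by (auto simp: fps_eq_iff W_def tangent_to_id_def)
  have h_pow: "(h ^ i) $ n = (if n < i then 0 else (W ^ i) $ (n - i))" for i n
    by (simp only: h_eq power_mult_distrib fps_X_power_mult_nth)
  \<comment> \<open>The term \<open>l = d\<close> of the composition is
    \<open>\<phi> $ (k + d)\<close> and cancels against the subtracted
    \<open>\<phi>\<close>.\<close>
  have diff: "compose_diff h \<phi> $ (k + d) = (\<Sum>l<d. \<phi> $ (k + l) * (W ^ (k + l)) $ (d - l))" for d
  proof -
    have "(\<phi> oo h) $ (k + d) = (\<Sum>i\<in>{k..<k + Suc d}. \<phi> $ i * (h ^ i) $ (k + d))"
      unfolding fps_compose_nth by (rule sum.mono_neutral_right) (auto simp: \<phi>)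
    also have "\<dots> = (\<Sum>l<Suc d. \<phi> $ (k + l) * (h ^ (k + l)) $ (k + d))"
      using sum.shift_bounds_nat_ivl[of "\<lambda>i. \<phi> $ i * (h ^ i) $ (k + d)" 0 k "Suc d"]
      by (simp add: atLeast0LessThan add.commute)
    also have "\<dots> = (\<Sum>l<d. \<phi> $ (k + l) * (W ^ (k + l)) $ (d - l)) + \<phi> $ (k + d)"
      by (simp add: h_pow Wpow(1))
    finally show ?thesis
      by (simp add: compose_diff_def)
  qed
  \<comment> \<open>For \<open>t < l < m + t\<close> the index \<open>m + t - l\<close> lies
    strictly between \<open>0\<close> and \<open>m\<close>, where powers of \<open>W\<close>
    vanish.\<close>
  have high: "compose_diff h \<phi> $ (k + (m + t)) =
      (\<Sum>l<Suc t. \<phi> $ (k + l) * (W ^ (k + l)) $ (m + t - l))" for t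
    unfolding diff by (rule sum.mono_neutral_right) (use m in \<open>auto simp: Wpow(2)\<close>)
  show "compose_diff h \<phi> $ n = 0" if "n < k + m" for n
  proof (cases "n < k")
    case True
    then show ?thesis
      using \<phi> by (simp add: compose_diff_def fps_compose_nth)
  next
    case False
    then obtain d where d: "n = k + d"
      using le_Suc_ex[of k n] by auto
    then have "d < m"
      using that by simp
    then show ?thesis
      by (simp add: diff Wpow(2) d)
  qed
  show "compose_diff h \<phi> $ (k + m) = of_nat k * \<phi> $ k * h $ (m + 1)"
    using high[of 0] Wpow(3) by (simp add: W_def)
  show "compose_diff h \<phi> $ (k + m + 1) =
      of_nat k * \<phi> $ k * h $ (m + 2) + of_nat (k + 1) * \<phi> $ (k + 1) * h $ (m + 1)"
    using high[of 1] Wpow(3)[of "k + 1"] Wpow(4)[of k]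
    by (simp add: W_def algebra_simps numeral_2_eq_2)
  show "compose_diff h \<phi> $ (k + m + 2) =
      \<phi> $ k * (of_nat k * h $ (m + 3) + of_bool (m = 2) * of_nat (k choose 2) * (h $ (m + 1))\<^sup>2)
      + of_nat (k + 1) * \<phi> $ (k + 1) * h $ (m + 2)
      + of_nat (k + 2) * \<phi> $ (k + 2) * h $ (m + 1)"
    using high[of 2] Wpow(3)[of "k + 2"] Wpow(4)[of "k + 1"] Wpow(5)[of k]
    by (simp add: W_def algebra_simps numeral_2_eq_2 numeral_3_eq_3)
qed

section \<open>The coefficient recursion over \<open>p\<close> steps\<close>

text \<open>
  Here \<open>2s + 3\<close> plays the role of \<open>p\<close>. Halfway, the factors \<open>2j + 3\<close> (at \<open>j = s\<close>) and \<open>2j + 1\<close> (at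
  \<open>j = s + 1\<close>) vanish, so that nothing before index \<open>s\<close> matters and the recursion beyond \<open>s + 1\<close>
  is solved by double factorials.
\<close>
lemma three_term_recursion:
  fixes \<alpha> \<beta> \<gamma> :: "nat \<Rightarrow> 'a::idom"
  assumes char: "2 * of_nat s + 3 = (0::'a)"
    and \<alpha>: "\<And>j. \<alpha> (Suc j) = (2 * of_nat j + 1) * b0 * \<alpha> j"
    and \<beta>: "\<And>j. \<beta> (Suc j) = (2 * of_nat j + 1) * b1 * \<alpha> j + (2 * of_nat j + 2) * b0 * \<beta> j"
    and \<gamma>: "\<And>j. \<gamma> (Suc j) = (2 * of_nat j + 1) * (b2 + of_nat j * e) * \<alpha> j
                    + (2 * of_nat j + 2) * b1 * \<beta> j + (2 * of_nat j + 3) * b0 * \<gamma> j"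
  shows "\<alpha> (2 * s + 3) = 0" and "\<beta> (2 * s + 3) = 0"
    and "b0 * \<gamma> (2 * s + 3) = b0 ^ (s + 2) * (\<Prod>l<s + 2. 2 * of_nat l + 2) * \<alpha> s *
           (2 * b1\<^sup>2 - 2 * b0 * b2 + 3 * b0 * e)"
proof -
  \<comment> \<open>Double factorials: \<open>ev i\<close> is (2i)!! and \<open>od i\<close> is (2i
    - 1)!!.\<close>
  define ev od :: "nat \<Rightarrow> 'a"
    where "ev = (\<lambda>i. \<Prod>l<i. 2 * of_nat l + 2)" and "od = (\<lambda>i. \<Prod>l<i. 2 * of_nat l + 1)"
  define r where "r = Suc s"
  have s: "2 * of_nat s = (- 3 :: 'a)"
    using char by (simp add: add_eq_0_iff2)
  have r: "2 * of_nat (r + i) = (2 * of_nat i - 1 :: 'a)" for i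
    using s by (simp add: r_def algebra_simps)
  \<comment> \<open>The product is needed because \<open>\<alpha> r\<close> itself may be nonzero:
    at \<open>i = 0\<close> the factor vanishes, and from \<open>r + 1\<close> on
    \<open>\<alpha>\<close> does.\<close>
  have \<alpha>_zero: "(2 * of_nat (r + i) + 1) * \<alpha> (r + i) = 0" for i
  proof (induction i)
    case 0
    show ?case using r[of 0] by simp
  next
    case (Suc i)
    have "\<alpha> (r + Suc i) = b0 * ((2 * of_nat (r + i) + 1) * \<alpha> (r + i))"
      by (simp add: \<alpha> algebra_simps)
    then show ?case using Suc by simp
  qed
  have \<beta>_high: "\<beta> (r + i) = od i * b0 ^ i * \<beta> r" for i
  proof (induction i)
    case (Suc i)
    have "\<beta> (r + Suc i) = b1 * ((2 * of_nat (r + i) + 1) * \<alpha> (r + i))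
        + (2 * of_nat (r + i) + 2) * b0 * \<beta> (r + i)"
      by (simp only: add_Suc_right \<beta>) (simp add: algebra_simps)
    then show ?case
      unfolding \<alpha>_zero[unfolded r] r Suc by (simp add: od_def algebra_simps)
  qed (simp add: od_def)
  \<comment> \<open>Multiplying by \<open>b0\<close> avoids a division. The \<open>ev\<close> part
    solves the homogeneous recursion, the \<open>od\<close> part is the response to the term with
    \<open>\<beta>\<close>.\<close>
  have \<gamma>_high: "b0 * \<gamma> (r + i) = b0 ^ i * (ev i * (b0 * \<gamma> r - b1 * \<beta> r) + od (Suc i) * b1 * \<beta> r)" for i
  proof (induction i)
    case (Suc i)
    have "\<gamma> (r + Suc i) = (b2 + of_nat (r + i) * e) * ((2 * of_nat (r + i) + 1) * \<alpha> (r + i))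
        + (2 * of_nat (r + i) + 2) * b1 * \<beta> (r + i) + (2 * of_nat (r + i) + 3) * b0 * \<gamma> (r + i)"
      by (simp only: add_Suc_right \<gamma>) (simp add: algebra_simps)
    then have eq: "\<gamma> (r + Suc i) = (2 * of_nat i + 1) * b1 * \<beta> (r + i) + (2 * of_nat i + 2) * (b0 * \<gamma> (r + i))"
      unfolding \<alpha>_zero[unfolded r] r by (simp add: algebra_simps)
    show ?case
      unfolding eq Suc \<beta>_high by (simp add: ev_def od_def algebra_simps)
  qed (simp add: ev_def od_def)
  \<comment> \<open>At \<open>j = s\<close> the three factors are \<open>- 2\<close>,
    \<open>- 1\<close> and \<open>0\<close>, so \<open>\<gamma> s\<close> drops out;
    \<open>\<beta> s\<close> then cancels in
    \<open>b0 * \<gamma> r - b1 * \<beta> r\<close>.\<close>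
  have \<beta>_r: "\<beta> r = - 2 * b1 * \<alpha> s - b0 * \<beta> s"
    unfolding r_def \<beta> s by simp
  have \<gamma>_r: "\<gamma> r = - 2 * (b2 + of_nat s * e) * \<alpha> s - b1 * \<beta> s"
    unfolding r_def \<gamma> s by simp
  have "b0 * \<gamma> r - b1 * \<beta> r = \<alpha> s * (2 * b1\<^sup>2 - 2 * b0 * b2 - (2 * of_nat s) * (b0 * e))"
    unfolding \<beta>_r \<gamma>_r by (simp add: algebra_simps power2_eq_square)
  then have core: "b0 * \<gamma> r - b1 * \<beta> r = \<alpha> s * (2 * b1\<^sup>2 - 2 * b0 * b2 + 3 * b0 * e)"
    unfolding s by simp
  \<comment> \<open>Both products contain the factor \<open>2 * s + 3\<close>, at
    \<open>l = s + 1\<close>.\<close>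
  have od_zero: "od (s + 2) = 0" "od (s + 3) = 0"
    using char by (simp_all add: od_def numeral_2_eq_2 numeral_3_eq_3 algebra_simps)
  have idx: "2 * s + 3 = r + (s + 2)"
    by (simp add: r_def)
  have "\<alpha> (r + Suc (s + 1)) = b0 * ((2 * of_nat (r + (s + 1)) + 1) * \<alpha> (r + (s + 1)))"
    by (simp only: add_Suc_right \<alpha>) (simp add: algebra_simps)
  then show "\<alpha> (2 * s + 3) = 0"
    unfolding idx \<alpha>_zero by simp
  show "\<beta> (2 * s + 3) = 0"
    unfolding idx \<beta>_high od_zero by simp
  have "od (Suc (s + 2)) = 0"
    using od_zero(2) by (simp add: numeral_3_eq_3)
  then show "b0 * \<gamma> (2 * s + 3) = b0 ^ (s + 2) * (\<Prod>l<s + 2. 2 * of_nat l + 2) * \<alpha> s *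
      (2 * b1\<^sup>2 - 2 * b0 * b2 + 3 * b0 * e)"
    unfolding idx \<gamma>_high core by (simp add: ev_def mult_ac)
qed

text \<open>Each difference raises the lowest degree by \<open>m\<close>, so the coefficients at
  \<open>m * j + 1\<close> to \<open>m * j + 3\<close> are tracked. As \<open>m\<close> equals 2 in
  the field, they obey \<open>three_term_recursion\<close> whatever \<open>m\<close> is.\<close>

lemma fps_iterate_prime_nth:
  fixes h :: "'a::field fps"
  assumes p: "prime p" "odd p" "CHAR('a) = p"
    and h: "tangent_to_id m h" and m: "m \<ge> 2" "of_nat m = (2::'a)"
    and nz: "h $ (m + 1) \<noteq> 0"
  shows "tangent_to_id (p * m + 2) (fps_iterate p h)"
    and "fps_iterate p h $ (p * m + 3) \<noteq> 0 \<longleftrightarrow>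
      2 * (h $ (m + 2))\<^sup>2 - 2 * h $ (m + 1) * h $ (m + 3)
        + 3 * of_bool (m = 2) * (h $ (m + 1)) ^ 3 \<noteq> 0"
proof -
  have "p \<ge> 3"
    using p prime_ge_2_nat[OF p(1)] by (cases "p = 2") auto
  moreover obtain k where "p = 2 * k + 1"
    using \<open>odd p\<close> by (rule oddE)
  ultimately have "p = 2 * (k - 1) + 3"
    by simp
  then obtain s where s: "p = 2 * s + 3"
    by blast
  have unit: "of_nat n \<noteq> (0::'a)" if "0 < n" "n < p" for n
    using that p by (auto simp: of_nat_eq_0_iff_char_dvd dest: dvd_imp_le)
  define D where "D j = (compose_diff h ^^ j) fps_X" for j
  have D_Suc: "D (Suc j) = compose_diff h (D j)" for j
    by (simp add: D_def)
  define \<alpha> \<beta> \<gamma> where "\<alpha> = (\<lambda>j. D j $ (m * j + 1))" and "\<beta> = (\<lambda>j. D j $ (m * j + 2))"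
    and "\<gamma> = (\<lambda>j. D j $ (m * j + 3))"
  have low: "D j $ n = 0" if "n < m * j + 1" for j n
    using that
  proof (induction j arbitrary: n)
    case 0
    then show ?case by (simp add: D_def)
  next
    case (Suc j)
    then show ?case
      unfolding D_Suc by (intro compose_diff_nth(1)[OF h m(1), of "m * j + 1"]) auto
  qed
  note step = compose_diff_nth(2-4)[where k = "m * j + 1" and \<phi> = "D j" for j, OF h m(1) low]
  have nat_k: "of_nat (m * j + 1) = (2 * of_nat j + 1 :: 'a)"
    "of_nat (m * j + 1 + 1) = (2 * of_nat j + 2 :: 'a)"
    "of_nat (m * j + 1 + 2) = (2 * of_nat j + 3 :: 'a)" for j
    using m(2) by simp_all
  \<comment> \<open>This yields the parameter \<open>e\<close> of the recursion: the quadratic term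
    occurs only for \<open>m = 2\<close>, and its binomial coefficient contains the factor
    \<open>2 * j + 1\<close>.\<close>
  have choose: "of_bool (m = 2) * of_nat ((m * j + 1) choose 2) =
      of_bool (m = 2) * ((2 * of_nat j + 1) * of_nat j :: 'a)" for j
  proof -
    have "(2 * j + 1) choose 2 = (2 * j + 1) * j"
      by (simp add: choose_two)
    then show ?thesis
      by (cases "m = 2") (simp_all add: algebra_simps del: binomial_Suc_Suc)
  qed
  have rec\<alpha>: "\<alpha> (Suc j) = (2 * of_nat j + 1) * h $ (m + 1) * \<alpha> j" for j
    using step(1)[of j] unfolding nat_k by (simp add: \<alpha>_def D_Suc algebra_simps)
  have rec\<beta>: "\<beta> (Suc j) = (2 * of_nat j + 1) * h $ (m + 2) * \<alpha> j
      + (2 * of_nat j + 2) * h $ (m + 1) * \<beta> j" for j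
    using step(2)[of j] unfolding nat_k by (simp add: \<alpha>_def \<beta>_def D_Suc algebra_simps)
  have rec\<gamma>: "\<gamma> (Suc j) =
      (2 * of_nat j + 1) * (h $ (m + 3) + of_nat j * (of_bool (m = 2) * (h $ (m + 1))\<^sup>2)) * \<alpha> j
      + (2 * of_nat j + 2) * h $ (m + 2) * \<beta> j + (2 * of_nat j + 3) * h $ (m + 1) * \<gamma> j" for j
    using step(3)[of j] unfolding nat_k choose
    by (simp add: \<alpha>_def \<beta>_def \<gamma>_def D_Suc algebra_simps numeral_3_eq_3)
  have "(of_nat p :: 'a) = 0"
    using p by (simp add: of_nat_eq_0_iff_char_dvd)
  then have char: "2 * of_nat s + 3 = (0::'a)"
    by (simp add: s)
  note res = three_term_recursion[OF char rec\<alpha> rec\<beta> rec\<gamma>, folded s]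
  have h0: "h $ 0 = 0"
    using h by (simp add: tangent_to_id_def)
  have it: "fps_iterate p h = fps_X + D p"
    unfolding D_def by (rule fps_iterate_prime_char) (use p h0 in auto)
  show "tangent_to_id (p * m + 2) (fps_iterate p h)"
    unfolding tangent_to_id_def
  proof (intro allI impI)
    fix n assume "n \<le> p * m + 2"
    then consider "n < m * p + 1" | "n = m * p + 1" | "n = m * p + 2"
      by (force simp: mult.commute)
    then have "D p $ n = 0"
      using res(1,2) low by cases (auto simp: \<alpha>_def \<beta>_def)
    then show "fps_iterate p h $ n = fps_X $ n"
      by (simp add: it)
  qed
  \<comment> \<open>Up to index \<open>s\<close> the multipliers are odd numbers below
    \<open>p\<close> times the nonzero leading coefficient.\<close>
  have \<alpha>_s: "j \<le> s \<Longrightarrow> \<alpha> j \<noteq> 0" for j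
  proof (induction j)
    case 0
    then show ?case by (simp add: \<alpha>_def D_def)
  next
    case (Suc j)
    have "of_nat (2 * j + 1) \<noteq> (0::'a)"
      using Suc.prems by (intro unit) (simp_all add: s)
    then show ?case
      using Suc nz by (simp add: rec\<alpha> add.commute)
  qed
  have "(\<Prod>l<s + 2. 2 * of_nat l + 2) \<noteq> (0::'a)"
  proof -
    have "2 * of_nat l + 2 \<noteq> (0::'a)" if "l < s + 2" for l
    proof -
      have "of_nat 2 * of_nat (l + 1) \<noteq> (0::'a)"
        using that unit[of 2] unit[of "l + 1"] by (simp add: s del: of_nat_add of_nat_Suc)
      then show ?thesis
        by (simp add: algebra_simps)
    qed
    then show ?thesis
      unfolding prod_zero_iff[OF finite_lessThan] by blast
  qed
  then have "h $ (m + 1) * \<gamma> p \<noteq> 0 \<longleftrightarrow>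
      2 * (h $ (m + 2))\<^sup>2 - 2 * h $ (m + 1) * h $ (m + 3)
        + 3 * h $ (m + 1) * (of_bool (m = 2) * (h $ (m + 1))\<^sup>2) \<noteq> 0"
    unfolding res(3) using \<alpha>_s[of s] nz by simp
  moreover have "fps_iterate p h $ (p * m + 3) = \<gamma> p"
    by (simp add: it \<gamma>_def mult.commute)
  ultimately show "fps_iterate p h $ (p * m + 3) \<noteq> 0 \<longleftrightarrow>
      2 * (h $ (m + 2))\<^sup>2 - 2 * h $ (m + 1) * h $ (m + 3)
        + 3 * of_bool (m = 2) * (h $ (m + 1)) ^ 3 \<noteq> 0"
    using nz by (simp add: power2_eq_square power3_eq_cube mult_ac)
qed

section \<open>Series commuting with \<open>g\<close>\<close>

text \<open>The mixed difference of the two series is computed in two ways and compared in degrees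
  \<open>m + 4\<close> and \<open>m + 5\<close>. Degree \<open>m + 3\<close> gives nothing, both
  leading factors being 3.\<close>

lemma commuting_nth:
  fixes g h :: "'a::field fps"
  assumes two: "(2::'a) \<noteq> 0"
    and g: "tangent_to_id 2 g" and h: "tangent_to_id m h"
    and m: "m > 2" "of_nat m = (2::'a)" and comm: "h oo g = g oo h"
  shows "g $ 3 * h $ (m + 2) = g $ 4 * h $ (m + 1)"
    and "2 * g $ 3 * h $ (m + 3) = 2 * g $ 5 * h $ (m + 1) - 3 * (g $ 3)\<^sup>2 * h $ (m + 1)"
proof -
  have g0: "g $ 0 = 0" and h0: "h $ 0 = 0"
    using g h by (simp_all add: tangent_to_id_def)
  \<comment> \<open>By commutation both sides equal \<open>h oo g - g - h + fps_X\<close>.\<close>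
  have eq: "compose_diff g (h - fps_X) = compose_diff h (g - fps_X)"
    using comm g0 h0 by (simp add: compose_diff_def fps_compose_sub_distrib)
  have lowh: "\<And>i. i < m + 1 \<Longrightarrow> (h - fps_X) $ i = 0"
    using h by (simp add: tangent_to_id_def)
  have lowg: "\<And>i. i < 3 \<Longrightarrow> (g - fps_X) $ i = 0"
    using g by (simp add: tangent_to_id_def)
  have X: "fps_X $ (m + i) = (0::'a)" for i
    using m(1) by simp
  have "2 * ((m + 1) choose 2) = (m + 1) * m"
    by (simp add: choose_two)
  then have "2 * of_nat ((m + 1) choose 2) = (of_nat ((m + 1) * m) :: 'a)"
    by (metis of_nat_mult of_nat_numeral)
  then have "2 * of_nat ((m + 1) choose 2) = (2 * 3 :: 'a)"
    using m(2) by simp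
  then have choose: "of_nat ((m + 1) choose 2) = (3 :: 'a)"
    using two by (simp only: mult_cancel_left) simp
  have nats: "of_nat (m + 1) = (3::'a)" "of_nat (m + 1 + 1) = (4::'a)" "of_nat (m + 1 + 2) = (5::'a)"
    using m(2) by simp_all
  note L = compose_diff_nth(3-4)[where k = "m + 1", OF g order_refl lowh, unfolded nats choose]
  note R = compose_diff_nth(3-4)[where k = 3, OF h less_imp_le[OF m(1)] lowg]
  have idx: "m + 1 + 2 + 1 = 3 + m + 1" "m + 1 + 2 + 2 = 3 + m + 2"
    by simp_all
  have e1: "3 * h $ (m + 1) * g $ 4 + 4 * h $ (m + 2) * g $ 3
      = 3 * g $ 3 * h $ (m + 2) + 4 * g $ 4 * h $ (m + 1)"
    using L(1) R(1) m(1) unfolding idx eq by (simp add: X)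
  then show *: "g $ 3 * h $ (m + 2) = g $ 4 * h $ (m + 1)"
    by (simp add: algebra_simps)
  have e2: "h $ (m + 1) * (3 * g $ 5 + 3 * (g $ 3)\<^sup>2) + 4 * h $ (m + 2) * g $ 4 + 5 * h $ (m + 3) * g $ 3
      = 3 * g $ 3 * h $ (m + 3) + 4 * g $ 4 * h $ (m + 2) + 5 * g $ 5 * h $ (m + 1)"
    using L(2) R(2) m(1) unfolding idx eq by (simp add: X eval_nat_numeral)
  then show "2 * g $ 3 * h $ (m + 3) = 2 * g $ 5 * h $ (m + 1) - 3 * (g $ 3)\<^sup>2 * h $ (m + 1)"
    by (simp add: algebra_simps)
qed

section \<open>The criterion for 2-ramification\<close>

lemma two_neq_0_odd_char:
  assumes "prime p" "odd p" "CHAR('a::comm_semiring_1) = p"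
  shows "(2::'a) \<noteq> 0"
proof
  assume "(2::'a) = 0"
  then have "p dvd 2"
    using assms(3) of_nat_eq_0_iff_char_dvd[of 2, where 'a = 'a] by simp
  then show False
    using assms(1,2) primes_dvd_imp_eq[OF assms(1) two_is_prime_nat] by auto
qed

lemma fps_ord_eq_enat_iff: "fps_ord k = enat m \<longleftrightarrow> (\<forall>i<m. k $ i = 0) \<and> k $ m \<noteq> 0"
  by (auto simp: fps_ord_def nth_less_subdegree_zero intro: subdegreeI)

text \<open>Division by \<open>fps_X\<close> lowers degrees by one, so order \<open>m\<close> puts
  the first deviation from the identity in degree \<open>m + 1\<close>. As \<open>m > 0\<close>,
  \<open>fps_X\<close> has no coefficient there to subtract.\<close>

lemma lower_ramification_eq_enat_iff:
  fixes g :: "'a::field fps"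
  assumes "g $ 0 = 0" "m > 0"
  shows "lower_ramification p n g = enat m \<longleftrightarrow>
    tangent_to_id m (fps_iterate (p ^ n) g) \<and> fps_iterate (p ^ n) g $ (m + 1) \<noteq> 0"
proof -
  define h where "h = fps_iterate (p ^ n) g"
  have "h $ 0 = 0"
    using assms(1) by (simp add: h_def fps_iterate_nth_0)
  then have "tangent_to_id m h \<longleftrightarrow> (\<forall>i<m. (h - fps_X) $ (i + 1) = 0)"
    unfolding tangent_to_id_def
    by (metis Suc_eq_plus1 Suc_le_eq eq_iff_diff_eq_0 fps_X_nth fps_sub_nth not0_implies_Suc zero_neq_one)
  then show ?thesis
    using assms(2) by (simp add: lower_ramification_def fps_ord_eq_enat_iff flip: h_def)
qed

theorem two_ramified_iff:
  fixes g :: "'a::field fps"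
  assumes p: "prime p" "odd p" "CHAR('a) = p" and g: "tangent_to_id 2 g"
  shows "two_ramified p g \<longleftrightarrow>
    g $ 3 \<noteq> 0 \<and> 2 * (g $ 4)\<^sup>2 - 2 * g $ 3 * g $ 5 + 3 * (g $ 3) ^ 3 \<noteq> 0"
proof -
  define R where "R = 2 * (g $ 4)\<^sup>2 - 2 * g $ 3 * g $ 5 + 3 * (g $ 3) ^ 3"
  \<comment> \<open>The target values satisfy \<open>M (Suc n) = p * M n + 2\<close>, the degree
    supplied by \<open>fps_iterate_prime_nth\<close>, and are all 2 modulo \<open>p\<close>.\<close>
  define M where "M n = 2 * (\<Sum>i\<le>n. p ^ i)" for n
  define H where "H n = fps_iterate (p ^ n) g" for n
  have p0: "(of_nat p :: 'a) = 0"
    using p by (simp add: of_nat_eq_0_iff_char_dvd)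
  have two: "(2::'a) \<noteq> 0"
    using p by (rule two_neq_0_odd_char)
  have g0: "g $ 0 = 0" and g1: "g $ 1 = 1"
    using g by (simp_all add: tangent_to_id_def)
  have M_0: "M 0 = 2"
    by (simp add: M_def)
  have M_Suc: "M (Suc n) = p * M n + 2" for n
    by (simp only: M_def sum.atMost_Suc_shift) (simp add: sum_distrib_left mult.left_commute)
  have M_ge: "M n \<ge> 2" for n
    by (cases n) (simp_all add: M_0 M_Suc)
  have M_char: "of_nat (M n) = (2::'a)" for n
    by (cases n) (simp_all add: M_0 M_Suc p0)
  have M_gt: "M (Suc n) > 2" for n
    using M_ge[of n] prime_gt_0_nat[OF p(1)] by (simp add: M_Suc)
  have H_0: "H 0 = g"
    by (simp add: H_def fps_iterate_def)
  have H_Suc: "H (Suc n) = fps_iterate p (H n)" for n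
    using g0 by (simp add: H_def fps_iterate_mult power_Suc2 del: power_Suc)
  have H_comm: "H n oo g = g oo H n" for n
    unfolding H_def using g0 by (rule fps_iterate_commute)
  have ramified: "two_ramified p g \<longleftrightarrow> (\<forall>n. tangent_to_id (M n) (H n) \<and> H n $ (M n + 1) \<noteq> 0)"
  proof -
    have "lower_ramification p n g = enat (M n) \<longleftrightarrow> tangent_to_id (M n) (H n) \<and> H n $ (M n + 1) \<noteq> 0" for n
      unfolding H_def using g0 M_ge[of n] by (intro lower_ramification_eq_enat_iff) auto
    then show ?thesis
      using g0 g1 by (simp add: two_ramified_def M_def)
  qed
  have first: "tangent_to_id (M 1) (H 1) \<and> (H 1 $ (M 1 + 1) \<noteq> 0 \<longleftrightarrow> R \<noteq> 0)" if "g $ 3 \<noteq> 0"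
    using fps_iterate_prime_nth[OF p g] that M_Suc[of 0] H_Suc[of 0] by (simp add: M_0 H_0 R_def eval_nat_numeral)
  have higher: "tangent_to_id (M n) (H n) \<and> H n $ (M n + 1) \<noteq> 0" if nz: "g $ 3 \<noteq> 0" "R \<noteq> 0" for n
  proof (induction n)
    case 0
    then show ?case using g nz by (simp add: M_0 H_0)
  next
    case (Suc n)
    show ?case
    \<comment> \<open>Only the step starting from \<open>g\<close> itself has \<open>m = 2\<close>
      and hence the cubic term; afterwards \<open>m > 2\<close>.\<close>
    proof (cases n)
      case 0
      then show ?thesis using first nz by simp
    next
      case (Suc n')
      define h m where "h = H n" and "m = M n"
      have h: "tangent_to_id m h" "h $ (m + 1) \<noteq> 0" and m: "m > 2" "of_nat m = (2::'a)"
        using Suc.IH M_gt[of n'] M_char Suc by (simp_all add: h_def m_def)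
      note comm = commuting_nth[OF two g h(1) m H_comm[of n, folded h_def]]
      \<comment> \<open>Scaling by the square of \<open>g $ 3\<close> lets both identities of
        \<open>commuting_nth\<close> be substituted. The cubic term of \<open>R\<close> returns
        through the term \<open>3 * (g $ 3)\<^sup>2\<close> there.\<close>
      have "(g $ 3)\<^sup>2 * (2 * (h $ (m + 2))\<^sup>2 - 2 * h $ (m + 1) * h $ (m + 3))
          = 2 * (g $ 3 * h $ (m + 2))\<^sup>2 - g $ 3 * h $ (m + 1) * (2 * g $ 3 * h $ (m + 3))"
        by (simp add: power2_eq_square algebra_simps)
      also have "\<dots> = (h $ (m + 1))\<^sup>2 * R"
        unfolding comm by (simp add: R_def power2_eq_square power3_eq_cube algebra_simps)
      finally have "2 * (h $ (m + 2))\<^sup>2 - 2 * h $ (m + 1) * h $ (m + 3) \<noteq> 0"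
        using h(2) nz(2) by auto
      then show ?thesis
        using fps_iterate_prime_nth[OF p h(1) less_imp_le[OF m(1)] m(2) h(2)] m(1)
        by (simp add: M_Suc H_Suc h_def[symmetric] m_def[symmetric] numeral_3_eq_3)
    qed
  qed
  show ?thesis
    unfolding ramified R_def[symmetric]
  proof
    assume *: "\<forall>n. tangent_to_id (M n) (H n) \<and> H n $ (M n + 1) \<noteq> 0"
    then have "g $ 3 \<noteq> 0"
      using *[rule_format, of 0] by (simp add: M_0 H_0)
    then show "g $ 3 \<noteq> 0 \<and> R \<noteq> 0"
      using first * by blast
  qed (use higher in blast)
qed

section \<open>The square of \<open>f\<close>\<close>

theorem corollary1:
  fixes p :: nat and a :: "nat \<Rightarrow> 'k :: field" and f :: "'k fps"
  assumes "prime p" and "odd p" and "CHAR('k) = p"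
    and "f = fps_X * (- 1 + Abs_fps (\<lambda>j. if j = 0 then 0 else a j))"
  shows "two_ramified p (fps_iterate 2 f) \<longleftrightarrow>
    (a 1 ^ 2 + a 2) *
      (11 * a 1 ^ 4 + 25 * a 1 ^ 2 * a 2 + 12 * a 1 * a 3 + 6 * a 2 ^ 2 + 4 * a 4) \<noteq> 0"
proof -
  define g where "g = fps_iterate 2 f"
  define c where "c = a 1 ^ 2 + a 2"
  define d where "d = 11 * a 1 ^ 4 + 25 * a 1 ^ 2 * a 2 + 12 * a 1 * a 3 + 6 * a 2 ^ 2 + 4 * a 4"
  have g_eq: "g = f oo f"
    by (simp add: g_def fps_iterate_def numeral_2_eq_2)
  \<comment> \<open>The factor \<open>fps_X\<close> shifts indices: \<open>a j\<close> stands in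
    degree \<open>j + 1\<close>.\<close>
  have f_nth: "f $ 0 = 0" "f $ Suc 0 = - 1" "f $ Suc (Suc n) = a (Suc n)" for n
    by (simp_all add: assms(4))
  note nth = fps_mult_nth f_nth eval_nat_numeral algebra_simps
  have f2: "f\<^sup>2 $ 2 = 1" "f\<^sup>2 $ 3 = - 2 * a 1" "f\<^sup>2 $ 4 = (a 1)\<^sup>2 - 2 * a 2"
    "f\<^sup>2 $ 5 = 2 * a 1 * a 2 - 2 * a 3"
    by (simp_all add: nth)
  have f3: "f ^ 3 $ 3 = - 1" "f ^ 3 $ 4 = 3 * a 1" "f ^ 3 $ 5 = 3 * a 2 - 3 * (a 1)\<^sup>2"
    by (simp_all add: nth)
  have f4: "f ^ 4 $ 4 = 1" "f ^ 4 $ 5 = - 4 * a 1"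
    by (simp_all add: nth)
  have f5: "f ^ 5 $ 5 = - 1"
    by (simp add: nth)
  have f_low: "f $ 0 = 0" "f $ 1 = - 1" "f $ 2 = a 1" "f $ 3 = a 2" "f $ 4 = a 3" "f $ 5 = a 4"
    by (simp_all add: f_nth eval_nat_numeral)
  have sums: "{0..2::nat} = {0,1,2}" "{0..3::nat} = {0,1,2,3}" "{0..4::nat} = {0,1,2,3,4}"
    "{0..5::nat} = {0,1,2,3,4,5}"
    by auto
  have g0: "g $ 0 = 0" and g1: "g $ 1 = 1"
    by (simp_all add: g_eq fps_compose_nth f_nth)
  have g2: "g $ 2 = 0"
    by (simp add: g_eq fps_compose_nth sums f_low[simplified] f2)
  have g3: "g $ 3 = - 2 * c"
    by (simp add: g_eq fps_compose_nth sums f_low[simplified] f2 f2[unfolded power2_eq_square] f3 c_def power2_eq_square algebra_simps)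
  have g4: "g $ 4 = a 1 * c"
    by (simp add: g_eq fps_compose_nth sums f_low[simplified] f2 f2[unfolded power2_eq_square] f3 f4 c_def power2_eq_square algebra_simps)
  have g5: "g $ 5 = - 2 * a 4 - 6 * a 1 * a 3 + 3 * (a 2)\<^sup>2 - (a 1)\<^sup>2 * a 2"
    by (simp add: g_eq fps_compose_nth sums f_low[simplified] f2 f2[unfolded power2_eq_square] f3 f4 f5 power2_eq_square algebra_simps)
  have "i \<le> 2 \<Longrightarrow> i = 0 \<or> i = 1 \<or> i = 2" for i :: nat
    by auto
  then have "tangent_to_id 2 g"
    using g0 g1 g2 by (fastforce simp: tangent_to_id_def)
  note iff = two_ramified_iff[OF assms(1-3) this]
  have two: "(2::'k) \<noteq> 0"
    using assms(1-3) by (rule two_neq_0_odd_char)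
  \<comment> \<open>Since \<open>g $ 3 = - 2 * c\<close> and 2 is invertible,
    \<open>c * d \<noteq> 0\<close> captures both conditions of the criterion.\<close>
  have "2 * (g $ 4)\<^sup>2 - 2 * g $ 3 * g $ 5 + 3 * (g $ 3) ^ 3 = - 2 * c * d"
    unfolding g3 g4 g5 by (simp add: c_def d_def eval_nat_numeral algebra_simps)
  then show ?thesis
    unfolding g_def[symmetric] c_def[symmetric] d_def[symmetric] iff using g3 two by simp
qed

end
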